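(* Let $(\sigma,\varepsilon,b)\in\mathbb{C}^3$. Then the system of equations $$\varepsilon(b-1)(b-2\sigma)(b+3\sigma-1)=0,$$ $$(b-1)(b-3\sigma+1)=0,$$ $$\{b^2-5b-2-3(b-2)\sigma\}\{\varepsilon^2(b-1)(7b-15\sigma+2)-9\}=0,$$ $$\varepsilon(b-2\sigma)(b+3\sigma-1)=0$$ is satisfied if and only if either $(\sigma,b)=\left(\frac{1}{3},0\right)$ (with $\varepsilon$ arbitrary), or $(\sigma,\varepsilon,b)\in\{(1,-3,2),\,(1,3,2),\,(2,0,1)\}$.
   Context: The complex numbers $\sigma,\varepsilon,b$ are the parameters of the Lorenz model $\frac{dx}{dt}=y-\sigma\varepsilon x$, $\frac{dy}{dt}=-xz+x-\varepsilon y$, $\frac{dz}{dt}=xy-\varepsilon b z$. *)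

theory Defs
  imports Complex_Main
begin

end

theory Submission
  imports Defs
begin

text \<open>
  The second equation says that \<open>b = 1\<close> or \<open>b = 3 * \<sigma> - 1\<close>.
  For \<open>b = 1\<close> the third equation becomes \<open>-9 * (3 * \<sigma> - 6) = 0\<close>, and then the
  fourth forces \<open>\<epsilon> = 0\<close>. On the line \<open>b = 3 * \<sigma> - 1\<close> the quadratic terms of the first
  factor of the third equation cancel and leave \<open>-4 * b\<close>, while the fourth equation reads
  \<open>2 * \<epsilon> * (\<sigma> - 1) * b = 0\<close>. So either \<open>b = 0\<close>, and both hold for every \<open>\<epsilon>\<close>, or
  \<open>b \<noteq> 0\<close> and the second factor of the third equation vanishes; this excludes \<open>\<epsilon> = 0\<close>,
  so \<open>\<sigma> = 1\<close> and the factor becomes \<open>\<epsilon>\<^sup>2 - 9\<close>.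
\<close>

theorem mainTheorem1:
  fixes \<sigma> \<epsilon> b :: complex
  shows
    "(\<epsilon> * (b - 1) * (b - 2 * \<sigma>) * (b + 3 * \<sigma> - 1) = 0
      \<and> (b - 1) * (b - 3 * \<sigma> + 1) = 0
      \<and> (b^2 - 5 * b - 2 - 3 * (b - 2) * \<sigma>) * (\<epsilon>^2 * (b - 1) * (7 * b - 15 * \<sigma> + 2) - 9) = 0
      \<and> \<epsilon> * (b - 2 * \<sigma>) * (b + 3 * \<sigma> - 1) = 0)
     \<longleftrightarrow> ((\<sigma>, b) = (1 / 3, 0)
          \<or> (\<sigma>, \<epsilon>, b) \<in> {(1, -3, 2), (1, 3, 2), (2, 0, 1)})"
  (is "?E1 \<and> ?E2 \<and> ?E3 \<and> ?E4 \<longleftrightarrow> ?S")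
proof
  assume "?E1 \<and> ?E2 \<and> ?E3 \<and> ?E4"
  then have E2: ?E2 and E3: ?E3 and E4: ?E4 by blast+
  from E2 consider (one) "b = 1" | (line) "b - 3 * \<sigma> + 1 = 0" by auto
  then show ?S
  proof cases
    case one
    have "3 * (\<sigma> - 2) = 0" using E3 by (simp add: one algebra_simps)
    then have \<sigma>: "\<sigma> = 2" by simp
    with E4 one have "\<epsilon> = 0" by simp
    with one \<sigma> show ?thesis by simp
  next
    case line
    then have b: "b = 3 * \<sigma> - 1" by algebra
    have f3: "b^2 - 5 * b - 2 - 3 * (b - 2) * \<sigma> = - 4 * b"
      unfolding b by algebra
    have f4: "\<epsilon> * (b - 2 * \<sigma>) * (b + 3 * \<sigma> - 1) = 2 * (\<epsilon> * (\<sigma> - 1) * b)"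
      unfolding b by algebra
    show ?thesis
    proof (cases "b = 0")
      case True
      then have "3 * \<sigma> = 1" using b by simp
      then have "\<sigma> = 1 / 3" by (simp add: field_simps)
      with True show ?thesis by simp
    next
      case False
      with E3[unfolded f3] have g: "\<epsilon>^2 * (b - 1) * (7 * b - 15 * \<sigma> + 2) = 9" by simp
      then have "\<epsilon> \<noteq> 0" by auto
      with E4 f4 False have \<sigma>: "\<sigma> = 1" by simp
      with b have b2: "b = 2" by simp
      from g have "\<epsilon>^2 = 3^2" by (simp add: \<sigma> b2)
      then have "\<epsilon> = 3 \<or> \<epsilon> = -3" by (simp only: power2_eq_iff)
      with \<sigma> b2 show ?thesis by auto
    qed
  qed
next
  assume ?S
  then consider "\<sigma> = 1 / 3" "b = 0" | "\<sigma> = 1" "\<epsilon> = -3" "b = 2"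
    | "\<sigma> = 1" "\<epsilon> = 3" "b = 2" | "\<sigma> = 2" "\<epsilon> = 0" "b = 1"
    by blast
  then show "?E1 \<and> ?E2 \<and> ?E3 \<and> ?E4"
    by cases (hypsubst, simp)+
qed

end
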